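(* Let $A$ be a unital semisimple commutative complex Banach algebra and $B$ a unital complex Banach algebra, and set \[ \Omega_A=\{f\in A:\ \|f-r\|<r \text{ for some real } r>0\},\qquad \Omega_B=\{a\in B:\ \|a-r\|<r \text{ for some real } r>0\}. \] Suppose that $U$ is an open subset of $A$ with $\Omega_A\subset U\subset A^{-1}$ and $(\mathbb C\setminus\{0\})U\subset U$, and that $V$ is an open subset of $B$ with $\Omega_B\subset V\subset B^{-1}$, $(\mathbb C\setminus\{0\})V\subset V$ and $V\Omega_B\subset V$ (where $V\Omega_B=\{vw:v\in V,\ w\in\Omega_B\}$). Let $g\in B^{-1}$. If $T:U\to gV=\{gv:v\in V\}$ is a surjective isometry (with respect to the metrics induced by the norms), then $T$ extends to a surjective real linear isometry from $A$ onto $B$.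
   Context: $A^{-1}$, $B^{-1}$ denote the groups of invertible elements; for real $r$, $r$ also denotes $r1$. $T$ is only assumed to be a distance-preserving bijection between the metric spaces $U$ and $gV$, not linear. *)

theory Defs
  imports "HOL-Analysis.Analysis"
begin

definition complex_alg_scalar :: "(complex \<Rightarrow> 'a::real_normed_algebra \<Rightarrow> 'a) \<Rightarrow> bool"
  where "complex_alg_scalar s \<longleftrightarrow>
    (\<forall>a b x. s a (s b x) = s (a * b) x) \<and>
    (\<forall>x. s 1 x = x) \<and>
    (\<forall>a x y. s a (x + y) = s a x + s a y) \<and>
    (\<forall>a b x. s (a + b) x = s a x + s b x) \<and>
    (\<forall>r x. s (complex_of_real r) x = r *\<^sub>R x) \<and>
    (\<forall>a x y. s a (x * y) = s a x * y) \<and>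
    (\<forall>a x y. s a (x * y) = x * s a y) \<and>
    (\<forall>a x. norm (s a x) = cmod a * norm x)"

definition alg_units :: "'a::ring_1 set"
  where "alg_units = {x. \<exists>y. x * y = 1 \<and> y * x = 1}"

text \<open>Two-sided ideals (in a unital complex algebra these are automatically
complex subspaces).\<close>
definition alg_ideal :: "'a::ring_1 set \<Rightarrow> bool"
  where "alg_ideal I \<longleftrightarrow> 0 \<in> I \<and> (\<forall>x\<in>I. \<forall>y\<in>I. x + y \<in> I) \<and> (\<forall>x\<in>I. - x \<in> I) \<and>
     (\<forall>x\<in>I. \<forall>a. a * x \<in> I \<and> x * a \<in> I)"

definition alg_maximal_ideal :: "'a::ring_1 set \<Rightarrow> bool"
  where "alg_maximal_ideal I \<longleftrightarrow> alg_ideal I \<and> I \<noteq> UNIV \<and>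
     (\<forall>J. alg_ideal J \<and> I \<subseteq> J \<and> J \<noteq> UNIV \<longrightarrow> J = I)"

text \<open>Semisimple (commutative case): the Jacobson radical, i.e. the intersection
of all maximal ideals, is zero.\<close>
definition semisimple :: "'a::ring_1 itself \<Rightarrow> bool"
  where "semisimple _ \<longleftrightarrow> \<Inter> {I::'a set. alg_maximal_ideal I} = {0}"

definition Omega :: "'a::real_normed_algebra_1 set"
  where "Omega = {a. \<exists>r::real. r > 0 \<and> norm (a - of_real r) < r}"

end

theory Submission
  imports Defs
begin

text \<open>By a local Mazur--Ulam argument \<open>T\<close> is affine on the convex open cone \<open>\<Omega>\<^sub>A\<close>, say \<open>T = L + b\<close>; since
  \<open>\<Omega>\<^sub>A\<close> overlaps its small rotations, the same formula holds on \<open>c \<Omega>\<^sub>A\<close> for all \<open>c \<noteq> 0\<close>. For an arbitrary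
  \<open>f \<in> U\<close> put \<open>q = L\<^sup>-\<^sup>1 (T f - b)\<close>. Then \<open>q\<close> and \<open>f\<close> are equidistant from every point of these cones, which
  makes \<open>q - f\<close> quasinilpotent, and \<open>q = f\<close> by semisimplicity. Finally \<open>U\<close> turns out to be invariant under
  translation by complex multiples of \<open>L\<^sup>-\<^sup>1 b\<close>, so this element is quasinilpotent as well and \<open>b = 0\<close>.
  That quasinilpotent elements lie in the radical is derived without holomorphic functional calculus,
  by averaging the resolvent over roots of unity.\<close>

subsection \<open>A local Mazur--Ulam theorem\<close>

text \<open>Vaisala's argument: with the reflection \<open>\<psi>\<close> in \<open>z\<close>, the isometry \<open>\<psi> h\<^sup>-\<^sup>1 \<psi> h\<close> displaces \<open>z\<close> twice
  as far as \<open>h\<close> does, which cannot be iterated in a bounded set.\<close>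
lemma isometry_fixes_center:
  fixes D :: "'a::real_normed_vector set" and z :: 'a
  assumes D: "bounded D" "z \<in> D" "\<And>x. x \<in> D \<Longrightarrow> 2 *\<^sub>R z - x \<in> D"
    and h: "bij_betw h D D" "\<And>x y. x \<in> D \<Longrightarrow> y \<in> D \<Longrightarrow> dist (h x) (h y) = dist x y"
  shows "h z = z"
proof -
  define E where "E = {h. bij_betw h D D \<and> (\<forall>x\<in>D. \<forall>y\<in>D. dist (h x) (h y) = dist x y)}"
  define \<psi> where "\<psi> x = 2 *\<^sub>R z - x" for x
  have \<psi>D: "\<psi> x \<in> D" if "x \<in> D" for x using D(3)[OF that] unfolding \<psi>_def .
  have \<psi>\<psi>[simp]: "\<psi> (\<psi> x) = x" for x by (simp add: \<psi>_def)
  have bij\<psi>: "bij_betw \<psi> D D"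
    by (rule bij_betw_byWitness[where f' = \<psi>]) (simp_all add: \<psi>D image_subset_iff)
  have dist\<psi>: "dist (\<psi> x) (\<psi> y) = dist x y" for x y
    by (simp add: \<psi>_def dist_norm norm_minus_commute)
  obtain K where K: "\<And>x y. x \<in> D \<Longrightarrow> y \<in> D \<Longrightarrow> dist x y \<le> K"
    using D(1) bounded_two_points[of D] by metis
  have EK: "dist (h z) z \<le> K" if "h \<in> E" for h
  proof -
    have "h z \<in> D" using that D(2) unfolding E_def by (blast dest: bij_betwE)
    then show ?thesis using K D(2) by blast
  qed
  have dbl: "\<exists>h'\<in>E. dist (h' z) z = 2 * dist (h z) z" if hE: "h \<in> E" for h
  proof
    let ?i = "inv_into D h"
    let ?h = "\<psi> \<circ> (?i \<circ> (\<psi> \<circ> h))"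
    have bh: "bij_betw h D D" and ih: "\<And>x y. x \<in> D \<Longrightarrow> y \<in> D \<Longrightarrow> dist (h x) (h y) = dist x y"
      using hE unfolding E_def by blast+
    have bi: "bij_betw ?i D D" using bh by (rule bij_betw_inv_into)
    have hi: "h (?i x) = x" if "x \<in> D" for x using bij_betw_inv_into_right[OF bh that] .
    have iD: "?i x \<in> D" if "x \<in> D" for x using bij_betw_apply[OF bi that] .
    have hD: "h x \<in> D" if "x \<in> D" for x using bij_betw_apply[OF bh that] .
    have di: "dist (?i x) (?i y) = dist x y" if "x \<in> D" "y \<in> D" for x y
      using ih[OF iD[OF that(1)] iD[OF that(2)]] by (simp only: hi that)
    have "bij_betw ?h D D"
      by (rule bij_betw_trans[OF bij_betw_trans[OF bij_betw_trans[OF bh bij\<psi>] bi] bij\<psi>])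
    moreover have "dist (?h x) (?h y) = dist x y" if "x \<in> D" "y \<in> D" for x y
      using that by (simp only: o_apply dist\<psi> di hD \<psi>D ih)
    ultimately show "?h \<in> E"
      unfolding E_def by blast
    have "\<psi> z = z" by (simp add: \<psi>_def scaleR_2)
    then have "dist (?h z) z = dist (\<psi> (?i (\<psi> (h z)))) (\<psi> z)"
      by simp
    also have "\<dots> = dist (?i (\<psi> (h z))) z" by (rule dist\<psi>)
    \<comment> \<open>Apply the isometry \<open>h\<close> to both points. The resulting pair
      \<open>\<psi> (h z)\<close>, \<open>h z\<close> is symmetric about \<open>z\<close>, which
      produces the factor 2.\<close>
    also have "\<dots> = dist (\<psi> (h z)) (h z)"
      using ih[OF iD[OF \<psi>D[OF hD[OF D(2)]]] D(2)] by (simp only: hi \<psi>D hD D(2))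
    also have "\<dots> = norm (2 *\<^sub>R (z - h z))"
      by (simp add: \<psi>_def dist_norm algebra_simps scaleR_2)
    also have "\<dots> = 2 * dist (h z) z" by (simp add: dist_norm norm_minus_commute)
    finally show "dist (?h z) z = 2 * dist (h z) z" .
  qed
  have pow: "\<exists>h'\<in>E. dist (h' z) z = 2 ^ n * dist (h z) z" if "h \<in> E" for h n
  proof (induction n)
    case 0 then show ?case using that by auto
  next
    case (Suc n) then show ?case using dbl by (metis mult.assoc power_Suc)
  qed
  have "h \<in> E" using h unfolding E_def by blast
  then have bound: "2 ^ n * dist (h z) z \<le> K" for n using pow EK by metis
  show ?thesis
  proof (rule ccontr)
    assume "h z \<noteq> z"
    then have d: "dist (h z) z > 0" by simp
    obtain n where "K / dist (h z) z < 2 ^ n" using real_arch_pow[of 2] by auto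
    then show False using bound[of n] d by (simp add: divide_less_eq)
  qed
qed

text \<open>The points at distance \<open>r\<close> from both \<open>f\<close> and \<open>g\<close>
  form a bounded set \<open>D\<close> symmetric about the midpoint \<open>z\<close>. Reflecting
  images in the midpoint of \<open>T f\<close> and \<open>T g\<close> and pulling back along
  \<open>T\<close> gives an isometry of \<open>D\<close>, which must fix \<open>z\<close>. The two
  balls keep \<open>D\<close> inside \<open>U\<close> and the reflected images inside the image of
  \<open>U\<close>.\<close>

lemma isometry_midpoint:
  fixes T :: "'a::real_normed_vector \<Rightarrow> 'b::real_normed_vector"
  assumes iso: "\<And>x y. x \<in> U \<Longrightarrow> y \<in> U \<Longrightarrow> dist (T x) (T y) = dist x y"
    and f: "ball f \<rho> \<subseteq> U" and Tf: "ball (T f) \<rho> \<subseteq> T ` U"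
    and g: "g \<in> U" "dist f g < \<rho>"
  shows "T ((1/2) *\<^sub>R (f + g)) = (1/2) *\<^sub>R (T f + T g)"
proof -
  define r where "r = dist f g / 2"
  have r\<rho>: "r < \<rho>" "0 < \<rho>" "0 \<le> r" using g(2) zero_le_dist[of f g] unfolding r_def by linarith+
  have fU: "f \<in> U" using f r\<rho> by auto
  define D where "D = {u. dist f u = r \<and> dist g u = r}"
  define z where "z = (1/2) *\<^sub>R (f + g)"
  have z2: "2 *\<^sub>R z = f + g" by (simp add: z_def)
  have DU: "D \<subseteq> U" using f r\<rho> by (auto simp: D_def)
  have mid: "dist p ((1/2) *\<^sub>R (p + q)) = dist p q / 2" for p q :: "'c::real_normed_vector"
  proof -
    have "p - (1/2) *\<^sub>R (p + q) = (1/2) *\<^sub>R (p - q)" by (simp add: algebra_simps flip: scaleR_2)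
    then show ?thesis by (simp add: dist_norm)
  qed
  have zD: "z \<in> D" using mid[of f g] mid[of g f] by (simp add: D_def z_def r_def add.commute dist_commute)
  have refl: "dist p (p + q - u) = dist q u" for p q u :: "'c::real_normed_vector"
    by (simp add: dist_norm norm_minus_commute)
  have D\<psi>: "f + g - x \<in> D" if "x \<in> D" for x
    using that refl[of f g x] refl[of g f x] by (simp add: D_def add.commute)
  have "bounded D"
    by (rule bounded_subset[of "cball f r"]) (auto simp: D_def)
  have inj: "inj_on T U"
    by (rule inj_onI) (metis dist_eq_0_iff iso)
  have ex: "\<exists>x\<in>D. T x = T f + T g - T u" if "u \<in> D" for u
  proof -
    have uU: "u \<in> U" using that DU by auto
    have 1: "dist (T f) (T f + T g - T u) = r" "dist (T g) (T f + T g - T u) = r"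
      using refl[of "T f" "T g" "T u"] refl[of "T g" "T f" "T u"] iso fU g(1) uU that
      by (auto simp: D_def add.commute)
    then have "T f + T g - T u \<in> T ` U" using Tf r\<rho> by auto
    then obtain x where x: "x \<in> U" "T x = T f + T g - T u" by auto
    then have "x \<in> D" using 1 iso[of f x] iso[of g x] fU g(1) by (simp add: D_def)
    then show ?thesis using x by auto
  qed
  \<comment> \<open>\<open>k\<close> is the reflection in the midpoint of \<open>T f\<close> and
    \<open>T g\<close>, transported to \<open>D\<close> by \<open>T\<close>. It is an involution,
    hence a bijection of \<open>D\<close>.\<close>
  define k where "k u = (SOME x. x \<in> D \<and> T x = T f + T g - T u)" for u
  have k: "k u \<in> D" "T (k u) = T f + T g - T u" if "u \<in> D" for u
    using ex[OF that] someI_ex[of "\<lambda>x. x \<in> D \<and> T x = T f + T g - T u"] unfolding k_def by blast+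
  have kk: "k (k u) = u" if "u \<in> D" for u
    using k[OF that] k(2)[of "k u"] k(1)[of "k u"] inj DU that
    by (metis (no_types, lifting) add_diff_cancel_left' diff_add_cancel inj_onD subsetD)
  have dk: "dist (k u) (k v) = dist u v" if "u \<in> D" "v \<in> D" for u v
  proof -
    have "dist (k u) (k v) = dist (T (k u)) (T (k v))" using k that DU iso by (metis subsetD)
    also have "\<dots> = dist (T u) (T v)" using k that by (simp add: dist_norm norm_minus_commute)
    also have "\<dots> = dist u v" using that DU iso by blast
    finally show ?thesis .
  qed
  have bk: "bij_betw k D D"
    by (rule bij_betw_byWitness[where f' = k]) (auto simp: kk k)
  have "k z = z"
    by (rule isometry_fixes_center[OF \<open>bounded D\<close> zD _ bk dk]) (auto simp: z2 D\<psi>)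
  then have "T z + T z = T f + T g" using k(2)[OF zD] by (simp add: algebra_simps)
  then show ?thesis unfolding z_def[symmetric]
    by (metis scaleR_half_double)
qed

text \<open>Compactness of the segment and of its image gives one radius \<open>\<rho>\<close> that
  suits the midpoint lemma at every point. On a fine grid the midpoint identities make all
  increments of \<open>T\<close> equal, so \<open>T\<close> is affine there; continuity carries this
  to every \<open>t\<close>.\<close>

lemma isometry_segment:
  fixes T :: "'a::real_normed_vector \<Rightarrow> 'b::real_normed_vector"
  assumes U: "open U" "open (T ` U)"
    and iso: "\<And>x y. x \<in> U \<Longrightarrow> y \<in> U \<Longrightarrow> dist (T x) (T y) = dist x y"
    and seg: "closed_segment f g \<subseteq> U" and t: "0 \<le> t" "t \<le> 1"
  shows "T (f + t *\<^sub>R (g - f)) = T f + t *\<^sub>R (T g - T f)"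
proof -
  have contT: "continuous_on U T"
    unfolding continuous_on_iff using iso by (metis dist_commute)
  obtain \<rho>1 where \<rho>1: "\<rho>1 > 0" "(\<Union>x\<in>closed_segment f g. ball x \<rho>1) \<subseteq> U"
    using compact_subset_open_imp_ball_epsilon_subset[OF compact_segment U(1) seg] by blast
  have "compact (T ` closed_segment f g)"
    using contT seg continuous_on_subset compact_continuous_image compact_segment by blast
  then obtain \<rho>2 where \<rho>2: "\<rho>2 > 0" "(\<Union>y\<in>T ` closed_segment f g. ball y \<rho>2) \<subseteq> T ` U"
    using compact_subset_open_imp_ball_epsilon_subset[OF _ U(2)] seg by (metis image_mono)
  define \<rho> where "\<rho> = min \<rho>1 \<rho>2"
  have \<rho>: "\<rho> > 0" using \<rho>1 \<rho>2 by (simp add: \<rho>_def)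
  have balls: "ball x \<rho> \<subseteq> U" "ball (T x) \<rho> \<subseteq> T ` U" if "x \<in> closed_segment f g" for x
  proof -
    have "ball x \<rho> \<subseteq> ball x \<rho>1" "ball (T x) \<rho> \<subseteq> ball (T x) \<rho>2" by (auto simp: \<rho>_def)
    then show "ball x \<rho> \<subseteq> U" "ball (T x) \<rho> \<subseteq> T ` U" using that \<rho>1(2) \<rho>2(2) by blast+
  qed
  have in_seg: "f + s *\<^sub>R (g - f) \<in> closed_segment f g" if "0 \<le> s" "s \<le> 1" for s
    using that unfolding in_segment by (intro exI[of _ s]) (simp add: algebra_simps)
  \<comment> \<open>The midpoint lemma is applied to points two grid steps apart, hence the factor 2
    in the mesh condition.\<close>
  have grid: "T (f + (real k / real N) *\<^sub>R (g - f)) = T f + (real k / real N) *\<^sub>R (T g - T f)"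
    if N: "N > 0" "2 * norm (g - f) / real N < \<rho>" and kN: "k \<le> N" for N k
  proof -
    define x where "x k = f + (real k / real N) *\<^sub>R (g - f)" for k
    have xs: "x k \<in> closed_segment f g" if "k \<le> N" for k
      unfolding x_def using that N by (intro in_seg) auto
    have step: "T (x (Suc (Suc k))) - T (x (Suc k)) = T (x (Suc k)) - T (x k)" if "Suc (Suc k) \<le> N" for k
    proof -
      have "x (Suc (Suc k)) - x k = (2 / real N) *\<^sub>R (g - f)"
        unfolding x_def using N by (simp add: add_divide_distrib algebra_simps)
      then have d: "dist (x k) (x (Suc (Suc k))) < \<rho>"
        using N by (metis abs_of_nonneg dist_commute dist_norm divide_nonneg_nonneg norm_scaleR of_nat_0_le_iff times_divide_eq_left zero_le_numeral)
      have m: "(1/2) *\<^sub>R (x k + x (Suc (Suc k))) = x (Suc k)"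
      proof -
        define p q where "p = real k / real N" and "q = 1 / real N"
        have "real (Suc k) / real N = p + q" "real (Suc (Suc k)) / real N = p + q + q"
          by (simp_all add: p_def q_def add_divide_distrib)
        then have "x (Suc k) = x k + q *\<^sub>R (g - f)" "x (Suc (Suc k)) = x k + q *\<^sub>R (g - f) + q *\<^sub>R (g - f)"
          by (simp_all only: x_def p_def[symmetric] scaleR_add_left add.assoc)
        then have "x k + x (Suc (Suc k)) = 2 *\<^sub>R x (Suc k)"
          by (simp only: scaleR_2 ac_simps)
        then show ?thesis by simp
      qed
      have "x (Suc (Suc k)) \<in> U" using xs that seg by blast
      then have "T (x (Suc k)) = (1/2) *\<^sub>R (T (x k) + T (x (Suc (Suc k))))"
        using isometry_midpoint[of U T "x k" \<rho> "x (Suc (Suc k))"] iso balls[of "x k"] xs[of k] that d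
        by (simp add: m)
      then have "2 *\<^sub>R T (x (Suc k)) = T (x k) + T (x (Suc (Suc k)))" by simp
      then show ?thesis by (simp add: scaleR_2 algebra_simps)
    qed
    have diff: "T (x (Suc k)) - T (x k) = T (x 1) - T (x 0)" if "Suc k \<le> N" for k
      using that by (induction k) (auto simp: step)
    have lin: "T (x k) = T (x 0) + real k *\<^sub>R (T (x 1) - T (x 0))" if "k \<le> N" for k
      using that
    proof (induction k)
      case (Suc k)
      then have "T (x (Suc k)) = T (x k) + (T (x 1) - T (x 0))"
        using diff[of k] by (simp add: algebra_simps)
      then show ?case using Suc by (simp add: algebra_simps)
    qed simp
    have x0: "x 0 = f" and xN: "x N = g" using N by (auto simp: x_def)
    have "T g - T f = real N *\<^sub>R (T (x 1) - T (x 0))"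
      using lin[of N] by (simp add: x0 xN)
    then have "(1 / real N) *\<^sub>R (T g - T f) = T (x 1) - T (x 0)" using N by simp
    then have "(real k / real N) *\<^sub>R (T g - T f) = real k *\<^sub>R (T (x 1) - T (x 0))"
      by (metis divide_inverse inverse_eq_divide scaleR_scaleR)
    then show ?thesis using lin[OF kN] by (simp add: x0 x_def[of k])
  qed
  \<comment> \<open>Rational approximations of \<open>t\<close> from below with denominator
    \<open>Suc n\<close>, so that each \<open>s n\<close> is a grid parameter in the unit
    interval.\<close>
  define s where "s n = real (nat \<lfloor>t * real (Suc n)\<rfloor>) / real (Suc n)" for n
  have s_bd: "t - 1 / real (Suc n) \<le> s n" "s n \<le> t" for n
  proof -
    have "t * real (Suc n) - 1 \<le> real (nat \<lfloor>t * real (Suc n)\<rfloor>)"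
      using t(1) by linarith
    then have "(t * real (Suc n) - 1) / real (Suc n) \<le> s n"
      unfolding s_def by (rule divide_right_mono) simp
    then show "t - 1 / real (Suc n) \<le> s n" by (simp add: field_simps)
    have "real (nat \<lfloor>t * real (Suc n)\<rfloor>) \<le> t * real (Suc n)" using t(1) by simp
    then show "s n \<le> t" unfolding s_def by (simp add: field_simps)
  qed
  have "(\<lambda>n. t - 1 / real (Suc n)) \<longlonglongrightarrow> t - 0"
    by (intro tendsto_diff tendsto_const LIMSEQ_Suc lim_1_over_n)
  then have s_lim: "s \<longlonglongrightarrow> t"
    using s_bd by (intro tendsto_sandwich[of "\<lambda>n. t - 1 / real (Suc n)" s sequentially "\<lambda>_. t"]) auto
  have s01: "0 \<le> s n" "s n \<le> 1" for n
    using order_trans[OF s_bd(2)[of n] t(2)] by (auto simp: s_def simp del: of_nat_Suc) (simp only: mult_1_left)?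
  have "(\<lambda>n. f + s n *\<^sub>R (g - f)) \<longlonglongrightarrow> f + t *\<^sub>R (g - f)"
    by (intro tendsto_intros s_lim)
  then have lim1: "(\<lambda>n. T (f + s n *\<^sub>R (g - f))) \<longlonglongrightarrow> T (f + t *\<^sub>R (g - f))"
    using in_seg s01 t seg by (intro continuous_on_tendsto_compose[OF contT]) (auto intro!: always_eventually)
  have "(\<lambda>n. 2 * norm (g - f) * (1 / real (Suc n))) \<longlonglongrightarrow> 2 * norm (g - f) * 0"
    by (intro tendsto_intros LIMSEQ_Suc lim_1_over_n)
  then have "\<forall>\<^sub>F n in sequentially. 2 * norm (g - f) / real (Suc n) < \<rho>"
    using \<rho> by (auto dest!: order_tendstoD(2)[where a = \<rho>])
  then have "\<forall>\<^sub>F n in sequentially. T (f + s n *\<^sub>R (g - f)) = T f + s n *\<^sub>R (T g - T f)"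
  proof eventually_elim
    case (elim n)
    have "t * real (Suc n) \<le> real (Suc n)" using t by (simp add: mult_left_le_one_le del: of_nat_Suc)
    then have "\<lfloor>t * real (Suc n)\<rfloor> \<le> \<lfloor>real (Suc n)\<rfloor>" by (rule floor_mono)
    then have "nat \<lfloor>t * real (Suc n)\<rfloor> \<le> Suc n" by (simp add: nat_le_iff del: of_nat_Suc)
    then show ?case using grid[of "Suc n" "nat \<lfloor>t * real (Suc n)\<rfloor>"] elim unfolding s_def by blast
  qed
  moreover have "(\<lambda>n. T f + s n *\<^sub>R (T g - T f)) \<longlonglongrightarrow> T f + t *\<^sub>R (T g - T f)"
    by (intro tendsto_intros s_lim)
  ultimately have "(\<lambda>n. T (f + s n *\<^sub>R (g - f))) \<longlonglongrightarrow> T f + t *\<^sub>R (T g - T f)"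
    by (simp add: tendsto_cong)
  then show ?thesis using lim1 LIMSEQ_unique by blast
qed

text \<open>\<open>L\<close> is the difference quotient of \<open>T\<close> at a base point
  \<open>x0\<close> of \<open>C\<close>. Affinity along segments makes it independent of the step
  size, and the case of midpoints makes it additive.\<close>

lemma isometry_affine_on_convex:
  fixes T :: "'a::real_normed_vector \<Rightarrow> 'b::real_normed_vector"
  assumes U: "open U" "open (T ` U)"
    and iso: "\<And>x y. x \<in> U \<Longrightarrow> y \<in> U \<Longrightarrow> dist (T x) (T y) = dist x y"
    and C: "open C" "convex C" "C \<noteq> {}" "C \<subseteq> U"
  obtains L b where "linear L" "surj L" "\<And>x. norm (L x) = norm x" "\<And>x. x \<in> C \<Longrightarrow> T x = L x + b"
proof -
  obtain x0 where x0: "x0 \<in> C" using C by blast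
  then obtain \<rho>1 where \<rho>1: "\<rho>1 > 0" "ball x0 \<rho>1 \<subseteq> C" using C(1) openE by blast
  obtain \<rho>2 where \<rho>2: "\<rho>2 > 0" "ball (T x0) \<rho>2 \<subseteq> T ` U" using U(2) x0 C(4) openE by (metis image_eqI subsetD)
  define \<rho> where "\<rho> = min \<rho>1 \<rho>2"
  have \<rho>: "\<rho> > 0" "ball x0 \<rho> \<subseteq> C" "ball (T x0) \<rho> \<subseteq> T ` U"
    using \<rho>1 \<rho>2 by (auto simp: \<rho>_def)
  have inC: "x0 + s *\<^sub>R x \<in> C" if "\<bar>s\<bar> * norm x < \<rho>" for s x
    using \<rho>(2) that by (auto simp: subset_iff dist_norm)
  have aff: "T (f + t *\<^sub>R (g - f)) = T f + t *\<^sub>R (T g - T f)"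
    if "f \<in> C" "g \<in> C" "0 \<le> t" "t \<le> 1" for f g t
    using isometry_segment[OF U iso _ that(3,4)] closed_segment_subset[OF that(1,2) C(2)] C(4) by blast
  \<comment> \<open>A step size keeping \<open>x0 + \<sigma> x *\<^sub>R x\<close> in the ball
    around \<open>x0\<close>; the summand 1 covers \<open>x = 0\<close>.\<close>
  define \<sigma> where "\<sigma> x = \<rho> / (2 * (norm x + 1))" for x :: 'a
  have \<sigma>: "\<sigma> x > 0" "\<sigma> x * norm x < \<rho>" for x
  proof -
    have n: "norm x + 1 > 0" by (simp add: add_nonneg_pos)
    then show "\<sigma> x > 0" using \<rho>(1) by (simp add: \<sigma>_def)
    have "\<rho> * norm x < \<rho> * (2 * (norm x + 1))" using \<rho>(1) n by (intro mult_strict_left_mono) auto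
    then show "\<sigma> x * norm x < \<rho>" using n by (simp add: \<sigma>_def divide_less_eq)
  qed
  define L where "L x = (1 / \<sigma> x) *\<^sub>R (T (x0 + \<sigma> x *\<^sub>R x) - T x0)" for x
  have scale: "T (x0 + (r * s) *\<^sub>R x) - T x0 = r *\<^sub>R (T (x0 + s *\<^sub>R x) - T x0)"
    if "0 \<le> r" "r \<le> 1" "x0 + s *\<^sub>R x \<in> C" for r s x
    using aff[OF x0 that(3) that(1,2)] by simp
  have Leq: "T (x0 + s *\<^sub>R x) - T x0 = s *\<^sub>R L x" if s: "s > 0" "x0 + s *\<^sub>R x \<in> C" for s x
  proof (cases "s \<le> \<sigma> x")
    case True
    then show ?thesis
      using scale[of "s / \<sigma> x" "\<sigma> x" x] inC[of "\<sigma> x" x] \<sigma>[of x] s by (simp add: L_def)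
  next
    case False
    then have "T (x0 + \<sigma> x *\<^sub>R x) - T x0 = (\<sigma> x / s) *\<^sub>R (T (x0 + s *\<^sub>R x) - T x0)"
      using scale[of "\<sigma> x / s" s x] \<sigma>[of x] s by simp
    then show ?thesis using \<sigma>(1)[of x] s by (simp add: L_def)
  qed
  have add: "L (x + y) = L x + L y" for x y
  proof -
    \<comment> \<open>Small enough for steps of length \<open>2 * s\<close> along \<open>x\<close>
      and \<open>y\<close>: the midpoint of the two endpoints is
      \<open>x0 + s *\<^sub>R (x + y)\<close>.\<close>
    define s where "s = min (\<sigma> x) (min (\<sigma> y) (\<sigma> (x + y))) / 2"
    have s: "s > 0" using \<sigma>(1) by (simp add: s_def)
    have sle: "2 * s * norm x \<le> \<sigma> x * norm x" "2 * s * norm y \<le> \<sigma> y * norm y"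
       "s * norm (x + y) \<le> \<sigma> (x + y) * norm (x + y)"
      using s \<sigma>(1)[of "x + y"] by (intro mult_right_mono; simp add: s_def min_def)+
    have in1: "x0 + (2 * s) *\<^sub>R x \<in> C" "x0 + (2 * s) *\<^sub>R y \<in> C" "x0 + s *\<^sub>R (x + y) \<in> C"
      using sle s \<sigma>(2)[of x] \<sigma>(2)[of y] \<sigma>(2)[of "x+y"] by (auto intro!: inC)
    have "s *\<^sub>R L (x + y) = T (x0 + s *\<^sub>R (x + y)) - T x0" using Leq in1 s by simp
    also have "x0 + s *\<^sub>R (x + y) =
        (x0 + (2 * s) *\<^sub>R x) + (1/2) *\<^sub>R ((x0 + (2 * s) *\<^sub>R y) - (x0 + (2 * s) *\<^sub>R x))"
    proof -
      have "(1/2) *\<^sub>R ((x0 + (2 * s) *\<^sub>R y) - (x0 + (2 * s) *\<^sub>R x)) = s *\<^sub>R y - s *\<^sub>R x"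
        by (simp add: scaleR_diff_right)
      moreover have "(2 * s) *\<^sub>R x = s *\<^sub>R x + s *\<^sub>R x" by (metis scaleR_2 scaleR_scaleR)
      ultimately show ?thesis by (simp only: scaleR_add_right) simp
    qed
    also have "T \<dots> = T (x0 + (2 * s) *\<^sub>R x) + (1/2) *\<^sub>R (T (x0 + (2 * s) *\<^sub>R y) - T (x0 + (2 * s) *\<^sub>R x))"
      using aff[OF in1(1,2), of "1/2"] by simp
    also have "\<dots> - T x0 = (1/2) *\<^sub>R ((T (x0 + (2 * s) *\<^sub>R x) - T x0) + (T (x0 + (2 * s) *\<^sub>R y) - T x0))"
      by (simp add: algebra_simps flip: scaleR_2)
    also have "\<dots> = s *\<^sub>R (L x + L y)"
      using Leq in1 s by (simp add: algebra_simps)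
    finally show ?thesis using s by simp
  qed
  have pos: "L (c *\<^sub>R x) = c *\<^sub>R L x" if c: "c > 0" for c x
  proof -
    have i: "x0 + \<sigma> (c *\<^sub>R x) *\<^sub>R (c *\<^sub>R x) \<in> C" using inC \<sigma> by (metis abs_of_pos)
    then have "\<sigma> (c *\<^sub>R x) *\<^sub>R L (c *\<^sub>R x) = (\<sigma> (c *\<^sub>R x) * c) *\<^sub>R L x"
      using Leq[of "\<sigma> (c *\<^sub>R x)" "c *\<^sub>R x"] Leq[of "\<sigma> (c *\<^sub>R x) * c" x] c \<sigma>(1)[of "c *\<^sub>R x"] by simp
    then have "\<sigma> (c *\<^sub>R x) *\<^sub>R L (c *\<^sub>R x) = \<sigma> (c *\<^sub>R x) *\<^sub>R (c *\<^sub>R L x)" by simp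
    then show ?thesis using \<sigma>(1)[of "c *\<^sub>R x"] by (metis less_irrefl scaleR_left_imp_eq)
  qed
  have L0: "L 0 = 0" using add[of 0 0] by simp
  have neg: "L (- x) = - L x" for x using add[of x "- x"] L0 by (simp add: eq_neg_iff_add_eq_0 add.commute)
  have linL: "linear L"
  proof (rule linearI[OF add])
    fix c x
    show "L (c *\<^sub>R x) = c *\<^sub>R L x"
    proof (cases c "0::real" rule: linorder_cases)
      case less
      then have "L ((- c) *\<^sub>R x) = (- c) *\<^sub>R L x" by (intro pos) simp
      then show ?thesis using neg[of "c *\<^sub>R x"] by simp
    qed (auto simp: L0 pos)
  qed
  have normL: "norm (L x) = norm x" for x
  proof -
    have "x0 + \<sigma> x *\<^sub>R x \<in> C" using inC \<sigma> by (metis abs_of_pos)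
    then have "dist (T (x0 + \<sigma> x *\<^sub>R x)) (T x0) = dist (x0 + \<sigma> x *\<^sub>R x) x0"
      using iso C(4) x0 by blast
    then have "norm (T (x0 + \<sigma> x *\<^sub>R x) - T x0) = \<sigma> x * norm x"
      using \<sigma>(1)[of x] by (simp add: dist_norm)
    then show ?thesis using \<sigma>(1)[of x] by (simp add: L_def)
  qed
  have TL: "T x = L x + (T x0 - L x0)" if "x \<in> C" for x
    using Leq[of 1 "x - x0"] that linear_diff[OF linL, of x x0] by (simp add: algebra_simps)
  \<comment> \<open>A small multiple of \<open>y\<close> added to \<open>T x0\<close> is still a
    value of \<open>T\<close>. Its preimage is as close to \<open>x0\<close>, hence lies in
    \<open>C\<close>, where the formula for \<open>L\<close> applies.\<close>
  have "\<exists>x. L x = y" for y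
  proof -
    define s where "s = \<rho> / (2 * (norm y + 1))"
    have n: "norm y + 1 > 0" by (simp add: add_nonneg_pos)
    have s: "s > 0" using n \<rho>(1) by (simp add: s_def)
    have "\<rho> * norm y < \<rho> * (2 * (norm y + 1))" using \<rho>(1) n by (intro mult_strict_left_mono) auto
    then have sy: "s * norm y < \<rho>" using n by (simp add: s_def divide_less_eq)
    then have "T x0 + s *\<^sub>R y \<in> T ` U" using \<rho>(3) s by (auto simp: subset_iff dist_norm)
    then obtain x where x: "x \<in> U" "T x = T x0 + s *\<^sub>R y" by auto
    have "dist x0 x < \<rho>" using iso[of x0 x] x x0 C(4) sy s by (auto simp: dist_norm)
    then have "x \<in> C" using \<rho>(2) by auto
    then have "L (x - x0) = s *\<^sub>R y" using Leq[of 1 "x - x0"] x(2) by simp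
    then have "L ((1 / s) *\<^sub>R (x - x0)) = y" using linear_scale[OF linL] s by simp
    then show ?thesis by blast
  qed
  then have "surj L" by (metis surjI)
  then show thesis using that linL normL TL by blast
qed

subsection \<open>Quasinilpotent elements of commutative Banach algebras\<close>

lemma alg_units_iff_dvd: "x \<in> alg_units \<longleftrightarrow> x dvd (1::'a::comm_ring_1)"
proof
  show "x dvd 1" if "x \<in> alg_units"
    using that unfolding alg_units_def by (auto intro: dvdI[OF sym])
  show "x \<in> alg_units" if "x dvd 1"
  proof -
    from that obtain y where "1 = x * y" by (rule dvdE)
    then have "x * y = 1 \<and> y * x = 1" by (simp add: mult.commute[of y x])
    then show ?thesis unfolding alg_units_def by blast
  qed
qed

lemma one_minus_unit:
  fixes x :: "'a::{real_normed_algebra_1, banach, comm_ring_1}"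
  assumes "norm x < 1"
  shows "1 - x dvd 1"
proof -
  have s: "summable (\<lambda>n. x ^ n)" using complete_algebra_summable_geometric[OF assms] .
  have "(\<Sum>n. x ^ n) = (\<Sum>n. x ^ Suc n) + 1"
    using suminf_split_head[OF s] by simp
  also have "(\<Sum>n. x ^ Suc n) = x * (\<Sum>n. x ^ n)"
    using suminf_mult[OF s, of x] by simp
  finally have "1 = (\<Sum>n. x ^ n) - x * (\<Sum>n. x ^ n)" by (metis add_diff_cancel_left')
  then have "1 = (1 - x) * (\<Sum>n. x ^ n)" by (simp only: left_diff_distrib mult_1_left)
  then show ?thesis by (rule dvdI)
qed

text \<open>\<open>1 - x\<close> divides \<open>1 - x ^ n\<close>, so a single small power
  suffices.\<close>

lemma one_minus_unit_of_power:
  fixes x :: "'a::{real_normed_algebra_1, banach, comm_ring_1}"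
  assumes "norm (x ^ n) < 1"
  shows "1 - x dvd 1"
proof -
  have "1 - x dvd 1 - x ^ n" using one_diff_power_eq[of x n] by simp
  then show ?thesis using one_minus_unit[OF assms] dvd_trans by blast
qed

text \<open>If a maximal ideal \<open>M\<close> missed \<open>a\<close>, then \<open>M\<close> and
  \<open>a\<close> would generate the whole ring, so some \<open>1 - y * a\<close> would lie in
  \<open>M\<close>. Being a unit, it would force \<open>M\<close> to be everything.\<close>

lemma semisimple_zero:
  fixes a :: "'a::comm_ring_1"
  assumes ss: "semisimple TYPE('a)" and a: "\<And>y. 1 - y * a dvd 1"
  shows "a = 0"
proof -
  have "a \<in> M" if M: "alg_maximal_ideal M" for M
  proof (rule ccontr)
    assume "a \<notin> M"
    have I: "alg_ideal M" "M \<noteq> UNIV" "\<And>J. alg_ideal J \<Longrightarrow> M \<subseteq> J \<Longrightarrow> J \<noteq> UNIV \<Longrightarrow> J = M"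
      using M by (auto simp: alg_maximal_ideal_def)
    have M0: "0 \<in> M" and Madd: "\<And>x y. x \<in> M \<Longrightarrow> y \<in> M \<Longrightarrow> x + y \<in> M"
      and Mneg: "\<And>x. x \<in> M \<Longrightarrow> - x \<in> M" and Mmul: "\<And>x c. x \<in> M \<Longrightarrow> c * x \<in> M"
      using I(1) unfolding alg_ideal_def by blast+
    define J where "J = {m + y * a | m y. m \<in> M}"
    have J: "alg_ideal J"
      unfolding alg_ideal_def
    proof (intro conjI ballI allI)
      show "0 \<in> J" unfolding J_def using M0 by (force intro: exI[of _ 0])
    next
      fix u v assume "u \<in> J" "v \<in> J"
      then obtain m y m' y' where "u = m + y * a" "v = m' + y' * a" "m \<in> M" "m' \<in> M"
        unfolding J_def by blast
      then have "u + v = (m + m') + (y + y') * a" "m + m' \<in> M" using Madd by (auto simp: algebra_simps)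
      then show "u + v \<in> J" unfolding J_def by blast
    next
      fix u assume "u \<in> J"
      then obtain m y where "u = m + y * a" "m \<in> M" unfolding J_def by blast
      then have "- u = - m + (- y) * a" "- m \<in> M" using Mneg by auto
      then show "- u \<in> J" unfolding J_def by blast
    next
      fix u c assume "u \<in> J"
      then obtain m y where "u = m + y * a" "m \<in> M" unfolding J_def by blast
      then have "c * u = c * m + (c * y) * a" "c * m \<in> M" using Mmul[of m c]
        by (simp_all add: distrib_left mult.assoc)
      then show "c * u \<in> J" "u * c \<in> J" unfolding J_def by (auto simp: mult.commute[of u c])
    qed
    have "M \<subseteq> J" unfolding J_def by (force intro: exI[of _ 0])
    moreover have "a \<in> J" unfolding J_def using M0 by (force intro: exI[of _ 0] exI[of _ 1])
    ultimately have "J = UNIV" using I(3) J \<open>a \<notin> M\<close> by blast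
    then obtain m y where m: "1 = m + y * a" "m \<in> M" unfolding J_def by blast
    then have "m = 1 - y * a" by (simp add: algebra_simps)
    then obtain k where "1 = m * k" using a[of y] by (auto simp: dvd_def)
    then have "1 \<in> M" using Mmul[OF m(2), of k] by (simp add: mult.commute)
    then have "M = UNIV" using Mmul by (metis UNIV_eq_I mult.right_neutral)
    then show False using I(2) by blast
  qed
  then have "a \<in> \<Inter> {I. alg_maximal_ideal I}" by blast
  then show ?thesis using ss unfolding semisimple_def by blast
qed

text \<open>Beyond \<open>n\<close>, the dyadic powers of \<open>x\<close> are dyadic powers of
  \<open>x ^ (2 ^ n)\<close>, an element of norm below 1.\<close>

lemma dyadic_powers_tendsto_0:
  fixes x :: "'a::real_normed_algebra_1"
  assumes "norm (x ^ (2 ^ n)) < 1"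
  shows "(\<lambda>m. x ^ (2 ^ m)) \<longlonglongrightarrow> 0"
proof -
  define y where "y = x ^ (2 ^ n)"
  have "(\<lambda>k. y ^ k) \<longlonglongrightarrow> 0"
  proof (rule Lim_null_comparison)
    show "\<forall>\<^sub>F k in sequentially. norm (y ^ k) \<le> norm y ^ k" by (simp add: norm_power_ineq)
    show "(\<lambda>k. norm y ^ k) \<longlonglongrightarrow> 0" using assms by (intro LIMSEQ_power_zero) (simp add: y_def)
  qed
  moreover have "filterlim (\<lambda>m::nat. (2::nat) ^ m) at_top sequentially"
    by (rule filterlim_subseq) (simp add: strict_mono_def)
  ultimately have "(\<lambda>m. y ^ (2 ^ m)) \<longlonglongrightarrow> 0" by (rule filterlim_compose)
  then have "(\<lambda>m. x ^ (2 ^ (m + n))) \<longlonglongrightarrow> 0" by (simp add: y_def power_add mult.commute flip: power_mult)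
  then show ?thesis by (rule LIMSEQ_offset)
qed

text \<open>The complex scalars are given by the embedding \<open>c \<mapsto> c \<cdot> 1\<close>.\<close>
locale complex_unital_algebra =
  fixes e :: "complex \<Rightarrow> 'a::{real_normed_algebra_1, banach, comm_ring_1}"
  assumes e_add: "e (b + c) = e b + e c"
    and e_mult: "e (b * c) = e b * e c"
    and e_of_real: "e (complex_of_real r) = of_real r"
    and norm_e_mult: "norm (e c * x) = cmod c * norm x"
begin

lemma e_0 [simp]: "e 0 = 0" using e_of_real[of 0] by simp
lemma e_1 [simp]: "e 1 = 1" using e_of_real[of 1] by simp
lemma norm_e [simp]: "norm (e c) = cmod c" using norm_e_mult[of c 1] by simp
lemma e_minus: "e (- c) = - e c"
proof -
  have "e c + e (- c) = 0" using e_add[of c "- c"] by simp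
  then show ?thesis by (metis minus_unique)
qed
lemma e_diff: "e (b - c) = e b - e c"
  using e_add[of b "- c"] e_minus[of c] by simp
lemma e_power: "e (c ^ n) = e c ^ n" by (induction n) (simp_all add: e_mult)
lemma e_inverse: "c \<noteq> 0 \<Longrightarrow> e (inverse c) * e c = 1"
  using e_mult[of "inverse c" c] by simp

text \<open>The resolvent identity bounds increments of \<open>F\<close> by values of
  \<open>F\<close>. It first gives continuity, then compactness of the disc bounds \<open>F\<close>,
  and the identity turns this bound into a Lipschitz constant.\<close>

lemma resolvent_lipschitz:
  assumes a: "\<And>z. 1 - e z * a dvd 1"
  obtains F C where "C > 0" "\<And>z. (1 - e z * a) * F z = 1"
    "\<And>z w. cmod z \<le> R \<Longrightarrow> cmod w \<le> R \<Longrightarrow> norm (F z - F w) \<le> C * cmod (z - w)"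
proof -
  have "\<exists>F. \<forall>z. (1 - e z * a) * F z = 1"
    using a unfolding dvd_def by metis
  then obtain F where F: "\<And>z. (1 - e z * a) * F z = 1" by blast
  have resolvent: "F z - F w = e (z - w) * (a * F z * F w)" for z w
  proof -
    have "F z - F w = F z * ((1 - e w * a) * F w) - F w * ((1 - e z * a) * F z)" by (simp add: F)
    also have "\<dots> = e (z - w) * (a * F z * F w)" by (simp add: algebra_simps e_diff)
    finally show ?thesis .
  qed
  have bnd: "norm (F z - F w) \<le> cmod (z - w) * (norm a * norm (F z) * norm (F w))" for z w
  proof -
    have "norm (a * F z * F w) \<le> norm a * norm (F z) * norm (F w)"
      by (meson mult_right_mono norm_ge_zero norm_mult_ineq order_trans)
    then show ?thesis unfolding resolvent norm_e_mult by (intro mult_left_mono) auto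
  qed
  have "isCont F w" for w
  proof -
    \<comment> \<open>For \<open>z\<close> within \<open>d\<close> of \<open>w\<close> the resolvent
      identity gives \<open>norm (F z - F w)\<close> \<le> \<open>norm (F z) / 2\<close>, so
      \<open>norm (F z)\<close> is at most twice \<open>norm (F w)\<close>.\<close>
    define d where "d = 1 / (2 * (norm a * norm (F w) + 1))"
    have p: "norm a * norm (F w) + 1 > 0" by (simp add: add_nonneg_pos)
    then have d: "d > 0" by (simp add: d_def)
    show ?thesis
      unfolding isCont_def
    proof (rule Lim_null[THEN iffD2], rule Lim_null_comparison)
      have "norm (F z - F w) \<le> cmod (z - w) * (norm a * (2 * norm (F w)) * norm (F w))"
        if z: "cmod (z - w) < d" for z
      proof -
        have "cmod (z - w) * (norm a * norm (F w)) \<le> d * (norm a * norm (F w) + 1)"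
          using z d by (intro mult_mono) auto
        also have "\<dots> = 1/2" using p by (simp add: d_def)
        finally have "cmod (z - w) * (norm a * norm (F w)) * norm (F z) \<le> 1/2 * norm (F z)"
          by (intro mult_right_mono) auto
        then have "norm (F z - F w) \<le> 1/2 * norm (F z)" using bnd[of z w] by (simp add: ac_simps)
        then have "norm (F z) \<le> 2 * norm (F w)" using norm_triangle_sub[of "F z" "F w"] by linarith
        then have "cmod (z - w) * (norm a * norm (F z) * norm (F w)) \<le> cmod (z - w) * (norm a * (2 * norm (F w)) * norm (F w))"
          by (intro mult_left_mono mult_right_mono) auto
        then show ?thesis using bnd[of z w] by linarith
      qed
      then show "\<forall>\<^sub>F z in at w. norm (F z - F w) \<le> cmod (z - w) * (norm a * (2 * norm (F w)) * norm (F w))"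
        using d unfolding eventually_at by (auto simp: dist_norm)
      have "((\<lambda>z. cmod (z - w) * (norm a * (2 * norm (F w)) * norm (F w))) \<longlongrightarrow> cmod (w - w) * (norm a * (2 * norm (F w)) * norm (F w))) (at w)"
        by (intro tendsto_intros)
      then show "((\<lambda>z. cmod (z - w) * (norm a * (2 * norm (F w)) * norm (F w))) \<longlongrightarrow> 0) (at w)"
        by simp
    qed
  qed
  then have "continuous_on (cball 0 R) F" by (simp add: continuous_at_imp_continuous_on)
  then have "bounded (F ` cball 0 R)"
    by (intro compact_imp_bounded compact_continuous_image compact_cball)
  then obtain B where B: "B > 0" "\<And>z. cmod z \<le> R \<Longrightarrow> norm (F z) \<le> B"
    unfolding bounded_pos by (auto simp: dist_norm)
  \<comment> \<open>The summand 1 keeps \<open>C\<close> positive even when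
    \<open>a = 0\<close>.\<close>
  define C where "C = (norm a + 1) * B * B"
  have "C > 0" using B(1) by (simp add: C_def add_nonneg_pos)
  moreover have "norm (F z - F w) \<le> C * cmod (z - w)" if "cmod z \<le> R" "cmod w \<le> R" for z w
  proof -
    have "norm a * norm (F z) * norm (F w) \<le> C"
      unfolding C_def using B that by (intro mult_mono) auto
    then have "cmod (z - w) * (norm a * norm (F z) * norm (F w)) \<le> cmod (z - w) * C"
      by (intro mult_left_mono) auto
    then show ?thesis using bnd[of z w] by (simp add: mult.commute)
  qed
  ultimately show thesis using that F by blast
qed

text \<open>Since \<open>(1 - x)\<inverse> + (1 + x)\<inverse> = 2 (1 - x\<^sup>2)\<inverse>\<close>, inverses of \<open>1 - (z a)\<^bsup>2^n\<^esup>\<close> are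
  averages of values of the resolvent over rotated arguments, hence inherit its Lipschitz constant.\<close>
lemma power_resolvent_lipschitz:
  assumes F: "\<And>z. (1 - e z * a) * F z = 1"
    and lip: "\<And>z w. cmod z \<le> R \<Longrightarrow> cmod w \<le> R \<Longrightarrow> norm (F z - F w) \<le> C * cmod (z - w)"
  shows "\<exists>G. (\<forall>z. (1 - (e z * a) ^ (2 ^ n)) * G z = 1) \<and>
    (\<forall>z w. cmod z \<le> R \<longrightarrow> cmod w \<le> R \<longrightarrow> norm (G z - G w) \<le> C * cmod (z - w))"
proof (induction n)
  case 0
  then show ?case using F lip by auto
next
  case (Suc n)
  then obtain G where G: "\<And>z. (1 - (e z * a) ^ (2 ^ n)) * G z = 1"
    and Glip: "\<And>z w. cmod z \<le> R \<Longrightarrow> cmod w \<le> R \<Longrightarrow> norm (G z - G w) \<le> C * cmod (z - w)" by blast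
  \<comment> \<open>A root of unity with \<open>2 ^ n\<close>-th power -1: rotating \<open>z\<close>
    by it changes the sign of \<open>(e z * a) ^ (2 ^ n)\<close>.\<close>
  define \<eta> where "\<eta> = cis (pi / 2 ^ n)"
  have "\<eta> ^ (2 ^ n) = cis (real (2 ^ n) * (pi / 2 ^ n))" unfolding \<eta>_def by (rule Complex.DeMoivre)
  also have "real (2 ^ n) * (pi / 2 ^ n) = pi" by simp
  finally have \<eta>: "\<eta> ^ (2 ^ n) = -1" "cmod \<eta> = 1" by (simp_all add: \<eta>_def)
  have rot: "(e (\<eta> * z) * a) ^ (2 ^ n) = - ((e z * a) ^ (2 ^ n))" for z
  proof -
    have "e \<eta> ^ (2 ^ n) = - 1" using e_power[of \<eta> "2 ^ n"] e_minus[of 1] unfolding \<eta>(1) e_1 by metis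
    then show ?thesis by (simp add: e_mult power_mult_distrib)
  qed
  define H where "H z = (1/2) *\<^sub>R (G z + G (\<eta> * z))" for z
  have "(1 - (e z * a) ^ (2 ^ Suc n)) * H z = 1" for z
  proof -
    define y where "y = (e z * a) ^ (2 ^ n)"
    have 1: "(1 - y) * G z = 1" "(1 + y) * G (\<eta> * z) = 1"
      using G[of z] G[of "\<eta> * z"] rot[of z] by (simp_all add: y_def)
    have "(1 - y * y) * (G z + G (\<eta> * z)) = (1 + y) * ((1 - y) * G z) + (1 - y) * ((1 + y) * G (\<eta> * z))"
      by (simp add: algebra_simps)
    also have "\<dots> = 2" by (simp add: 1)
    finally have "(1 - y * y) * H z = (1/2) *\<^sub>R 2" by (simp add: H_def)
    also have "\<dots> = 1" by (metis scaleR_half_double one_add_one)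
    finally show ?thesis by (simp add: y_def power_mult power2_eq_square mult.commute flip: power_mult_distrib power_add mult_2)
  qed
  moreover have "norm (H z - H w) \<le> C * cmod (z - w)" if "cmod z \<le> R" "cmod w \<le> R" for z w
  proof -
    have "norm (G (\<eta> * z) - G (\<eta> * w)) \<le> C * cmod (\<eta> * z - \<eta> * w)"
      using that \<eta>(2) by (intro Glip) (auto simp: norm_mult)
    also have "cmod (\<eta> * z - \<eta> * w) = cmod (z - w)"
      using \<eta>(2) by (simp add: norm_mult flip: right_diff_distrib)
    finally have 2: "norm (G (\<eta> * z) - G (\<eta> * w)) \<le> C * cmod (z - w)" .
    have "H z - H w = (1/2) *\<^sub>R ((G z - G w) + (G (\<eta> * z) - G (\<eta> * w)))"
      by (simp add: H_def algebra_simps)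
    then have "norm (H z - H w) = norm ((G z - G w) + (G (\<eta> * z) - G (\<eta> * w))) / 2"
      by simp
    also have "\<dots> \<le> C * cmod (z - w)"
      using norm_triangle_ineq[of "G z - G w" "G (\<eta> * z) - G (\<eta> * w)"] 2 Glip[OF that] by linarith
    finally show ?thesis .
  qed
  ultimately show ?case by blast
qed

text \<open>A continuation in the radius: if some dyadic power of \<open>s *\<^sub>R a\<close> has
  norm below 1 and \<open>s\<close> \<le> \<open>r\<close>, the same holds at
  \<open>s + \<delta> / 2\<close>. The step \<open>\<delta>\<close> depends only on the Lipschitz
  constant, which is common to all dyadic powers, so finitely many steps starting from 0 pass
  \<open>r\<close>.\<close>

lemma quasinilpotent:
  assumes a: "\<And>z. 1 - e z * a dvd 1" and r: "r \<ge> 0"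
  shows "\<exists>n. norm ((r *\<^sub>R a) ^ (2 ^ n)) < 1"
proof (rule ccontr)
  assume contra: "\<not> ?thesis"
  define P where "P s \<longleftrightarrow> (\<exists>n. norm ((s *\<^sub>R a) ^ (2 ^ n)) < 1)" for s
  have down: "P s" if Pt: "P t" and s: "0 \<le> s" "s \<le> t" for s t
  proof -
    obtain n where n: "norm ((t *\<^sub>R a) ^ (2 ^ n)) < 1" using Pt unfolding P_def by blast
    have "norm ((s *\<^sub>R a) ^ (2 ^ n)) = s ^ (2 ^ n) * norm (a ^ (2 ^ n))"
      using s by (simp add: scaleR_power)
    also have "\<dots> \<le> t ^ (2 ^ n) * norm (a ^ (2 ^ n))"
      using s by (intro mult_right_mono power_mono) auto
    also have "\<dots> = norm ((t *\<^sub>R a) ^ (2 ^ n))"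
      using s by (simp add: scaleR_power)
    finally show ?thesis using n unfolding P_def by (meson le_less_trans)
  qed
  obtain F C where C: "C > 0" and F: "\<And>z. (1 - e z * a) * F z = 1"
    and lip: "\<And>z w. cmod z \<le> r + 1 \<Longrightarrow> cmod w \<le> r + 1 \<Longrightarrow> norm (F z - F w) \<le> C * cmod (z - w)"
    using resolvent_lipschitz[OF a, of "r + 1"] by metis
  \<comment> \<open>The bound 1 keeps \<open>s + \<delta>\<close> in the disc of radius
    \<open>r + 1\<close>; the other bound limits the change of the inverses over a step
    \<open>\<delta>\<close> to 1/4.\<close>
  define \<delta> where "\<delta> = min 1 (1 / (4 * C))"
  have \<delta>: "\<delta> > 0" "\<delta> \<le> 1" "C * \<delta> \<le> 1/4"
    using C by (auto simp: \<delta>_def min_def field_simps)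
  have e_scale: "e (complex_of_real s) * a = s *\<^sub>R a" for s by (simp add: e_of_real scaleR_conv_of_real)
  have step: "P (s + \<delta> / 2)" if s: "P s" "0 \<le> s" "s \<le> r" for s
  proof -
    obtain n where "norm ((s *\<^sub>R a) ^ (2 ^ n)) < 1" using s by (auto simp: P_def)
    then have "(\<lambda>m. (s *\<^sub>R a) ^ (2 ^ m)) \<longlonglongrightarrow> 0" by (rule dyadic_powers_tendsto_0)
    then have ev1: "\<forall>\<^sub>F m in sequentially. norm ((s *\<^sub>R a) ^ (2 ^ m)) < 1/5"
      by (intro order_tendstoD(2)[OF tendsto_norm_zero]) simp_all
    \<comment> \<open>The ratio by which the target \<open>s + \<delta> / 2\<close> falls short of
      \<open>s + \<delta>\<close>. At \<open>s + \<delta>\<close> the power is only shown to be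
      bounded by 3; the factor \<open>q ^ (2 ^ m)\<close> then makes it small.\<close>
    define q where "q = (s + \<delta> / 2) / (s + \<delta>)"
    have q: "0 \<le> q" "q < 1" using s \<delta> by (auto simp: q_def)
    have "(\<lambda>k. q ^ k) \<longlonglongrightarrow> 0" using q by (intro LIMSEQ_power_zero) simp
    moreover have "filterlim (\<lambda>m::nat. (2::nat) ^ m) at_top sequentially"
      by (rule filterlim_subseq) (simp add: strict_mono_def)
    ultimately have "(\<lambda>m. q ^ (2 ^ m)) \<longlonglongrightarrow> 0" by (rule filterlim_compose)
    then have ev2: "\<forall>\<^sub>F m in sequentially. q ^ (2 ^ m) < 1/4"
      by (rule order_tendstoD) simp
    \<comment> \<open>The thresholds give in turn \<open>norm (u - 1)\<close> \<le> 1/4,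
      \<open>norm (v - 1)\<close> \<le> 1/2, \<open>norm (1 - y)\<close> \<le> 2 and
      \<open>norm y\<close> \<le> 3, and finally the bound 3/4.\<close>
    obtain m where m: "norm ((s *\<^sub>R a) ^ (2 ^ m)) < 1/5" "q ^ (2 ^ m) < 1/4"
      using eventually_happens[OF eventually_conj[OF ev1 ev2]] by auto
    obtain G where G: "\<And>z. (1 - (e z * a) ^ (2 ^ m)) * G z = 1"
      and Glip: "\<And>z w. cmod z \<le> r + 1 \<Longrightarrow> cmod w \<le> r + 1 \<Longrightarrow> norm (G z - G w) \<le> C * cmod (z - w)"
      using power_resolvent_lipschitz[of a F "r + 1" C m] F lip by blast
    define x y u v where "x = (s *\<^sub>R a) ^ (2 ^ m)" and "y = ((s + \<delta>) *\<^sub>R a) ^ (2 ^ m)"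
      and "u = G (complex_of_real s)" and "v = G (complex_of_real (s + \<delta>))"
    have xu: "(1 - x) * u = 1" and yv: "(1 - y) * v = 1"
      unfolding x_def y_def u_def v_def e_scale[symmetric] by (rule G)+
    have "norm (v - u) \<le> C * cmod (complex_of_real (s + \<delta>) - complex_of_real s)"
      unfolding u_def v_def using s \<delta> by (intro Glip) (auto simp del: of_real_add)
    then have vu: "norm (v - u) \<le> 1/4" using \<delta> by simp
    have u1: "u - 1 = x + x * (u - 1)" using xu by (simp add: algebra_simps)
    have "norm (x * (u - 1)) \<le> 1/5 * norm (u - 1)"
      using m(1) norm_mult_ineq[of x "u - 1"] mult_right_mono[of "norm x" "1/5" "norm (u - 1)"]
      by (simp add: x_def)
    then have "norm (u - 1) \<le> 1/5 + 1/5 * norm (u - 1)"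
      using norm_triangle_ineq[of x "x * (u - 1)"] m(1) u1 x_def by (smt (verit))
    then have "norm (u - 1) \<le> 1/4" by simp
    then have v1: "norm (v - 1) \<le> 1/2" using vu norm_triangle_ineq[of "v - u" "u - 1"] by simp
    have "1 - y = 1 - (1 - y) * (v - 1)" using yv by (simp add: algebra_simps)
    moreover have "norm ((1 - y) * (v - 1)) \<le> norm (1 - y) * (1/2)"
      using v1 norm_mult_ineq[of "1 - y" "v - 1"] mult_left_mono[of "norm (v - 1)" "1/2" "norm (1 - y)"] by simp
    ultimately have "norm (1 - y) \<le> 1 + norm (1 - y) * (1/2)"
      using norm_triangle_ineq4[of 1 "(1 - y) * (v - 1)"] by (metis add_left_mono norm_one order_trans)
    then have "norm (1 - y) \<le> 2" by simp
    then have y3: "norm y \<le> 3" using norm_triangle_ineq4[of 1 "1 - y"] by simp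
    have "s + \<delta> / 2 = q * (s + \<delta>)" using s \<delta> by (simp add: q_def)
    then have "((s + \<delta> / 2) *\<^sub>R a) ^ (2 ^ m) = q ^ (2 ^ m) *\<^sub>R y"
      unfolding y_def by (metis scaleR_power scaleR_scaleR)
    then have "norm (((s + \<delta> / 2) *\<^sub>R a) ^ (2 ^ m)) = q ^ (2 ^ m) * norm y"
      using q by simp
    also have "\<dots> \<le> 1/4 * 3" using m(2) y3 q by (intro mult_mono) auto
    finally show ?thesis unfolding P_def by (intro exI[of _ m]) simp
  qed
  have "\<not> P r" using contra by (simp add: P_def)
  have all: "P (real k * (\<delta> / 2))" for k
  proof (induction k)
    case 0
    show ?case unfolding P_def by (intro exI[of _ 0]) simp
  next
    case (Suc k)
    have "real k * (\<delta> / 2) \<le> r" using down[OF Suc r] \<open>\<not> P r\<close> by fastforce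
    then have "P (real k * (\<delta> / 2) + \<delta> / 2)" using step[OF Suc] \<delta>(1) by simp
    moreover have "real (Suc k) * (\<delta> / 2) = real k * (\<delta> / 2) + \<delta> / 2" by (simp add: field_simps)
    ultimately show ?case by (simp only:)
  qed
  obtain k where "r / (\<delta> / 2) < real k" using reals_Archimedean2 by blast
  then have "r \<le> real k * (\<delta> / 2)" using \<delta> by (simp add: field_simps)
  then show False using down[OF all r] \<open>\<not> P r\<close> by blast
qed

text \<open>By commutativity, dyadic powers of \<open>y * a\<close> are dominated in norm by those
  of \<open>norm y *\<^sub>R a\<close>. Some power is thus small, every \<open>1 - y * a\<close> is
  a unit, and \<open>a\<close> lies in the radical.\<close>

lemma resolvent_entire_imp_zero:
  assumes ss: "semisimple TYPE('a)" and a: "\<And>z. 1 - e z * a dvd 1"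
  shows "a = 0"
proof (rule semisimple_zero[OF ss])
  fix y :: 'a
  obtain n where n: "norm ((norm y *\<^sub>R a) ^ (2 ^ n)) < 1" using quasinilpotent[OF a, of "norm y"] by auto
  have "norm ((y * a) ^ (2 ^ n)) \<le> norm (y ^ (2 ^ n)) * norm (a ^ (2 ^ n))"
    by (simp add: power_mult_distrib norm_mult_ineq)
  also have "\<dots> \<le> norm y ^ (2 ^ n) * norm (a ^ (2 ^ n))"
    by (intro mult_right_mono norm_power_ineq) auto
  also have "\<dots> < 1" using n by (simp add: scaleR_power)
  finally show "1 - y * a dvd 1" by (rule one_minus_unit_of_power)
qed

end

subsection \<open>Isometries on cones of invertible elements\<close>

text \<open>Differences along small vectors determine the linear part. This glues the affine
  formulas found on overlapping cones.\<close>

lemma affine_eq_on_open: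
  fixes L L' :: "'a::real_normed_vector \<Rightarrow> 'b::real_normed_vector"
  assumes lin: "linear L" "linear L'" and W: "open W" "W \<noteq> {}"
    and eq: "\<And>x. x \<in> W \<Longrightarrow> L x + b = L' x + b'"
  shows "L = L'" "b = b'"
proof -
  obtain w where "w \<in> W" using W(2) by blast
  then obtain \<rho> where w: "w \<in> W" "\<rho> > 0" "ball w \<rho> \<subseteq> W" using openE[OF W(1)] by blast
  show LL: "L = L'"
  proof
    fix x :: 'a
    define s where "s = \<rho> / (2 * (norm x + 1))"
    have n: "norm x + 1 > 0" by (simp add: add_nonneg_pos)
    have s: "s > 0" using n w(2) by (simp add: s_def)
    have "\<rho> * norm x < \<rho> * (2 * (norm x + 1))" using w(2) n by (intro mult_strict_left_mono) auto
    then have "s * norm x < \<rho>" using n by (simp add: s_def divide_less_eq)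
    then have "w + s *\<^sub>R x \<in> W" using w(3) s by (auto simp: subset_iff dist_norm)
    then have "L (w + s *\<^sub>R x) + b - (L w + b) = L' (w + s *\<^sub>R x) + b' - (L' w + b')"
      using eq w(1) by simp
    then have "s *\<^sub>R L x = s *\<^sub>R L' x"
      by (simp add: linear_add[OF lin(1)] linear_add[OF lin(2)] linear_scale[OF lin(1)] linear_scale[OF lin(2)])
    then show "L x = L' x" using s by simp
  qed
  show "b = b'" using eq[OF w(1)] by (simp add: LL)
qed

section \<open>Openness, convexity and rotations of \<open>Omega\<close>\<close>

lemma Omega_eq_UN_ball: "Omega = (\<Union>r\<in>{0<..}. ball (of_real r) r)"
  unfolding Omega_def by (auto simp: dist_norm norm_minus_commute)

lemma open_Omega: "open Omega"
  unfolding Omega_eq_UN_ball by blast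

text \<open>The balls making up \<open>Omega\<close> are nested, so any two of its points share a
  ball; convexity follows.\<close>

lemma Omega_radius_mono:
  assumes "norm (x - of_real r) < r" "r \<le> (s::real)"
  shows "norm (x - of_real s :: 'a::real_normed_algebra_1) < s"
proof -
  have "norm (x - of_real s) \<le> norm (x - of_real r) + norm (of_real r - of_real s :: 'a)"
    using norm_triangle_ineq[of "x - of_real r" "of_real r - of_real s"] by simp
  also have "norm (of_real r - of_real s :: 'a) = s - r"
    using assms(2) by (simp flip: of_real_diff)
  finally show ?thesis using assms(1) by simp
qed

lemma convex_Omega: "convex (Omega :: 'a::real_normed_algebra_1 set)"
proof (rule convexI)
  fix x y :: 'a and u v :: real
  assume xy: "x \<in> Omega" "y \<in> Omega" and uv: "0 \<le> u" "0 \<le> v" "u + v = 1"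
  obtain r s where rs: "r > 0" "norm (x - of_real r) < r" "s > 0" "norm (y - of_real s) < s"
    using xy by (auto simp: Omega_def)
  define t where "t = max r s"
  have "x \<in> ball (of_real t) t" "y \<in> ball (of_real t) t"
    using Omega_radius_mono[OF rs(2), of t] Omega_radius_mono[OF rs(4), of t]
    by (auto simp: t_def dist_norm norm_minus_commute)
  then have "u *\<^sub>R x + v *\<^sub>R y \<in> ball (of_real t) t"
    using convexD[OF convex_ball _ _ uv] by blast
  moreover have "t > 0" using rs by (simp add: t_def)
  ultimately show "u *\<^sub>R x + v *\<^sub>R y \<in> Omega" unfolding Omega_eq_UN_ball by auto
qed

context complex_unital_algebra
begin

lemma e_in_Omega:
  assumes "Re d > 0"
  shows "e d \<in> Omega"
proof -
  \<comment> \<open>This \<open>r\<close> turns \<open>(cmod (d - r))\<^sup>2\<close> into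
    \<open>r\<^sup>2 - (cmod d)\<^sup>2\<close>.\<close>
  define r where "r = (cmod d)\<^sup>2 / Re d"
  have d0: "d \<noteq> 0" using assms by auto
  have r: "r > 0" using assms d0 by (simp add: r_def)
  have "(cmod (d - complex_of_real r))\<^sup>2 = (cmod d)\<^sup>2 - 2 * (r * Re d) + r\<^sup>2"
    unfolding cmod_power2 by (simp add: power2_eq_square algebra_simps)
  also have "r * Re d = (cmod d)\<^sup>2" using assms by (simp add: r_def)
  finally have "(cmod (d - complex_of_real r))\<^sup>2 < r\<^sup>2" using d0 by simp
  then have "cmod (d - complex_of_real r) < r" using r by (simp add: power2_less_imp_less)
  then have "norm (e d - of_real r) < r" by (metis e_diff e_of_real norm_e)
  then show ?thesis using r by (auto simp: Omega_def)
qed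

lemma e_cancel:
  assumes "c \<noteq> 0"
  shows "e c * (e (inverse c) * x) = x" "e (inverse c) * (e c * x) = x"
proof -
  have 1: "e (inverse c) * e c = 1" "e c * e (inverse c) = 1"
    using e_inverse[OF assms] by (simp_all add: mult.commute[of "e c"])
  show "e c * (e (inverse c) * x) = x" "e (inverse c) * (e c * x) = x"
    unfolding mult.assoc[symmetric] 1 by simp_all
qed

lemma rotated_Omega:
  assumes "c \<noteq> 0"
  shows "open ((\<lambda>x. e c * x) ` Omega)" "convex ((\<lambda>x. e c * x) ` Omega)"
proof -
  have lin: "linear (\<lambda>x. e c * x)" by (rule linearI) (simp_all add: distrib_left)
  then show "convex ((\<lambda>x. e c * x) ` Omega)" using convex_Omega by (rule convex_linear_image)
  have "(\<lambda>x. e c * x) ` Omega = (\<lambda>x. e (inverse c) * x) -` Omega"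
    using e_cancel[OF assms] by (auto simp: image_iff) (metis e_cancel[OF assms])
  then show "open ((\<lambda>x. e c * x) ` Omega)"
    using open_vimage[OF open_Omega, of "\<lambda>x. e (inverse c) * x"] by (simp add: continuous_intros)
qed

text \<open>\<open>T\<close> is affine on each rotated cone. Rotating by \<open>d\<close> with
  \<open>Re d > 0\<close> gives a cone overlapping the previous one, so both carry the same formula,
  and every nonzero \<open>c\<close> is reached from 1 by finitely many such rotations.\<close>

lemma isometry_affine_on_rotated_Omega:
  fixes T :: "'a \<Rightarrow> 'b::real_normed_vector"
  assumes U: "open U" "open (T ` U)" "Omega \<subseteq> U" and cone: "\<And>c u. c \<noteq> 0 \<Longrightarrow> u \<in> U \<Longrightarrow> e c * u \<in> U"
    and iso: "\<And>x y. x \<in> U \<Longrightarrow> y \<in> U \<Longrightarrow> dist (T x) (T y) = dist x y"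
  obtains L b where "linear L" "surj L" "\<And>x. norm (L x) = norm x"
    "\<And>c x. c \<noteq> 0 \<Longrightarrow> x \<in> Omega \<Longrightarrow> T (e c * x) = L (e c * x) + b"
proof -
  have one: "(1::'a) \<in> Omega" using e_in_Omega[of 1] by simp
  have rotU: "(\<lambda>x. e c * x) ` Omega \<subseteq> U" if "c \<noteq> 0" for c using that cone U(3) by blast
  obtain L b where L: "linear L" "surj L" "\<And>x. norm (L x) = norm x" and Lb: "\<And>x. x \<in> Omega \<Longrightarrow> T x = L x + b"
    using isometry_affine_on_convex[OF U(1,2) iso open_Omega convex_Omega _ U(3)] one by blast
  define P where "P c \<longleftrightarrow> (\<forall>x\<in>Omega. T (e c * x) = L (e c * x) + b)" for c
  have step: "P (c * d)" if "P c" "c \<noteq> 0" "Re d > 0" for c d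
  proof -
    have cd: "c * d \<noteq> 0" using that by auto
    let ?C = "(\<lambda>x. e c * x) ` Omega" and ?D = "(\<lambda>x. e (c * d) * x) ` Omega"
    have "e (c * d) \<in> ?C" using e_in_Omega[OF that(3)] unfolding e_mult by (rule imageI)
    moreover have "e (c * d) \<in> ?D" using one by (intro image_eqI[of _ _ 1]) simp_all
    ultimately have ne: "?C \<inter> ?D \<noteq> {}" "?D \<noteq> {}" by blast+
    obtain L' b' where L': "linear L'" and Lb': "\<And>x. x \<in> ?D \<Longrightarrow> T x = L' x + b'"
      using isometry_affine_on_convex[OF U(1,2) iso rotated_Omega[OF cd] ne(2) rotU[OF cd]] by metis
    have op: "open (?C \<inter> ?D)" using rotated_Omega(1) cd that(2) by blast
    have eq: "L x + b = L' x + b'" if "x \<in> ?C \<inter> ?D" for x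
    proof -
      have "T x = L x + b" using \<open>P c\<close> that unfolding P_def by blast
      moreover have "T x = L' x + b'" using Lb' that by blast
      ultimately show ?thesis by simp
    qed
    have "L = L'" "b = b'" using affine_eq_on_open[OF L(1) L' op ne(1) eq] by blast+
    then show ?thesis unfolding P_def using Lb' by blast
  qed
  have "P 1" using Lb by (simp add: P_def)
  have "P c" if "c \<noteq> 0" for c
  proof -
    \<comment> \<open>A principal square root has nonnegative real part but may be purely imaginary;
      the square root of that has positive real part. Hence \<open>c\<close> is reached in four
      steps.\<close>
    define d where "d = csqrt (csqrt c)"
    have "d \<noteq> 0" using that by (simp add: d_def)
    have "csqrt c \<noteq> 0" using that by simp
    have "Re (csqrt c) \<ge> 0" using csqrt_principal[of c] by linarith
    moreover have "cmod (csqrt c) > 0" using \<open>csqrt c \<noteq> 0\<close> by simp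
    ultimately have "(cmod (csqrt c) + Re (csqrt c)) / 2 > 0" by (intro half_gt_zero add_pos_nonneg)
    then have d: "Re d > 0" unfolding d_def csqrt.simps(1)[of "csqrt c"] real_sqrt_gt_0_iff .
    have dd: "d * d = csqrt c" "csqrt c * csqrt c = c"
      unfolding d_def by (simp_all flip: power2_eq_square)
    have "c = 1 * d * d * d * d" using dd by (simp add: mult.assoc)
    then show ?thesis using step[OF step[OF step[OF step[OF \<open>P 1\<close> _ d] _ d] _ d] _ d] \<open>d \<noteq> 0\<close> by simp
  qed
  then show thesis using that L unfolding P_def by blast
qed

text \<open>Taking the points \<open>f - c\<close> of \<open>-c \<Omega>\<close> shows that \<open>h = q - f\<close> satisfies \<open>\<parallel>h + c\<parallel> = \<bar>c\<bar>\<close> for all large complex \<open>c\<close>.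
  Hence \<open>\<lambda> - h = (\<lambda> + c) - (c + h)\<close> is invertible for \<open>\<lambda> \<noteq> 0\<close>: choose \<open>c\<close> a large positive multiple of \<open>\<lambda>\<close>.\<close>
lemma eq_if_equidistant:
  assumes ss: "semisimple TYPE('a)"
    and eq: "\<And>c x. c \<noteq> 0 \<Longrightarrow> x \<in> Omega \<Longrightarrow> norm (q - e c * x) = norm (f - e c * x)"
  shows "q = f"
proof -
  define h where "h = q - f"
  have big: "norm (h + e c) = cmod c" if c: "norm f < cmod c" for c
  proof -
    have c0: "c \<noteq> 0" using c by auto
    define x where "x = 1 - e (inverse c) * f"
    have "norm (x - of_real 1) = norm f / cmod c"
      by (simp add: x_def norm_e_mult norm_inverse) (simp add: divide_inverse)
    also have "\<dots> < 1" using c c0 by (simp add: divide_less_eq)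
    finally have "x \<in> Omega" unfolding Omega_def by (intro CollectI exI[of _ 1]) simp
    moreover have "e (- c) * x = f - e c"
      using e_cancel(1)[OF c0, of f] by (simp add: x_def e_minus right_diff_distrib)
    ultimately have "norm (q - (f - e c)) = norm (f - (f - e c))" using eq[of "- c" x] c0 by simp
    then show ?thesis by (simp add: h_def algebra_simps)
  qed
  have "1 - e z * h dvd 1" for z
  proof (cases "z = 0")
    case False
    \<comment> \<open>With \<open>c = s / z\<close> this gives \<open>norm f < cmod c\<close> and
      \<open>z * c = s\<close>, a positive real.\<close>
    define s where "s = cmod z * norm f + 1"
    have s: "s > 0" by (simp add: s_def add_nonneg_pos)
    define c where "c = complex_of_real s * inverse z"
    have "cmod c = s / cmod z" using s by (simp add: c_def norm_mult norm_inverse divide_inverse)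
    moreover have "norm f < s / cmod z" using False by (simp add: s_def field_simps)
    ultimately have "norm f < cmod c" by simp
    then have "norm (e z * (h + e c)) = s"
      using big False s by (simp add: norm_e_mult c_def norm_mult norm_inverse)
    also have "z * c = complex_of_real s" using False by (simp add: c_def)
    then have "e z * (h + e c) = e z * h + of_real s"
      by (simp add: distrib_left flip: e_mult e_of_real)
    finally have ns: "norm (e z * h + of_real s) = s" .
    \<comment> \<open>Normalised so that \<open>1 - e z * h\<close> is \<open>1 + s\<close> times
      \<open>1 - y\<close>, while \<open>norm y = s / (1 + s)\<close> is below 1.\<close>
    define y where "y = inverse (1 + s) *\<^sub>R (e z * h + of_real s)"
    have "norm y = s / (1 + s)" using ns s by (simp add: y_def divide_inverse mult.commute)
    then have "norm y < 1" using s by simp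
    then have "1 - y dvd 1" by (rule one_minus_unit)
    moreover have "1 - e z * h = of_real (1 + s) * (1 - y)"
    proof -
      have "of_real (1 + s) * y = e z * h + of_real s"
        using s unfolding scaleR_conv_of_real[symmetric] by (simp add: y_def)
      then show ?thesis by (simp add: right_diff_distrib)
    qed
    moreover have "(of_real (1 + s) :: 'a) dvd 1"
    proof (rule dvdI)
      show "1 = (of_real (1 + s) :: 'a) * of_real (inverse (1 + s))"
        using s unfolding of_real_mult[symmetric] by simp
    qed
    ultimately show ?thesis by (metis mult_dvd_mono mult_1_left)
  qed simp
  then have "h = 0" by (rule resolvent_entire_imp_zero[OF ss])
  then show ?thesis by (simp add: h_def)
qed

text \<open>The point \<open>q\<close> that the affine map sends to \<open>T f\<close> has the same
  distances as \<open>f\<close> to all points of the rotated cones, and these distances determine a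
  point.\<close>

lemma isometry_on_cone_affine:
  fixes T :: "'a \<Rightarrow> 'b::real_normed_vector"
  assumes ss: "semisimple TYPE('a)"
    and U: "open U" "open (T ` U)" "Omega \<subseteq> U" and cone: "\<And>c u. c \<noteq> 0 \<Longrightarrow> u \<in> U \<Longrightarrow> e c * u \<in> U"
    and iso: "\<And>x y. x \<in> U \<Longrightarrow> y \<in> U \<Longrightarrow> dist (T x) (T y) = dist x y"
  obtains L b where "linear L" "surj L" "\<And>x. norm (L x) = norm x" "\<And>x. x \<in> U \<Longrightarrow> T x = L x + b"
proof -
  obtain L b where L: "linear L" "surj L" "\<And>x. norm (L x) = norm x"
    and Lb: "\<And>c x. c \<noteq> 0 \<Longrightarrow> x \<in> Omega \<Longrightarrow> T (e c * x) = L (e c * x) + b"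
    using isometry_affine_on_rotated_Omega[OF U cone iso] by metis
  have "T f = L f + b" if f: "f \<in> U" for f
  proof -
    obtain q where q: "L q = T f - b" using L(2) by (metis surjE)
    have "q = f"
    proof (rule eq_if_equidistant[OF ss])
      fix c :: complex and x :: 'a assume cx: "c \<noteq> 0" "x \<in> Omega"
      have "norm (q - e c * x) = norm (L q - L (e c * x))" by (metis L(1,3) linear_diff)
      also have "\<dots> = dist (T f) (T (e c * x))" by (simp add: q Lb[OF cx] dist_norm diff_diff_eq add.commute)
      also have "\<dots> = norm (f - e c * x)" using iso f cone cx U(3) by (metis dist_norm subsetD)
      finally show "norm (q - e c * x) = norm (f - e c * x)" .
    qed
    then show ?thesis using q by simp
  qed
  then show thesis using that L by blast
qed

text \<open>With \<open>L a = b\<close>, the homogeneity of both \<open>U\<close> and its image \<open>L U + b\<close> forces \<open>U + z a \<subseteq> U\<close> for every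
  complex \<open>z\<close>, so that \<open>1 - z a\<close> is always invertible.\<close>
lemma translation_zero:
  fixes L :: "'a \<Rightarrow> 'b::real_normed_vector"
  assumes ss: "semisimple TYPE('a)"
    and U: "Omega \<subseteq> U" "U \<subseteq> alg_units" and cone: "\<And>c u. c \<noteq> 0 \<Longrightarrow> u \<in> U \<Longrightarrow> e c * u \<in> U"
    and coneW: "\<And>t w. t \<noteq> 0 \<Longrightarrow> w \<in> (\<lambda>x. L x + b) ` U \<Longrightarrow> t *\<^sub>R w \<in> (\<lambda>x. L x + b) ` U"
    and L: "linear L" "surj L" "inj L"
  shows "b = 0"
proof -
  define W where "W = (\<lambda>x. L x + b) ` U"
  obtain a where a: "L a = b" using L(2) by (metis surjE)
  have rU: "t *\<^sub>R u \<in> U" if "t \<noteq> 0" "u \<in> U" for t u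
    using cone[of "complex_of_real t" u] that by (simp add: e_of_real scaleR_conv_of_real)
  \<comment> \<open>Shrink the \<open>U\<close>-component by \<open>1 + s\<close> and enlarge the
    image by the same factor: the linear part is restored and only the constant \<open>b\<close> is
    rescaled.\<close>
  have shift': "w + s *\<^sub>R b \<in> W" if w: "w \<in> W" and s: "s \<noteq> -1" for w s
  proof -
    obtain u where u: "u \<in> U" "w = L u + b" using w by (auto simp: W_def)
    have s1: "1 + s \<noteq> 0" using s by linarith
    have "L (inverse (1 + s) *\<^sub>R u) + b \<in> W" using rU[OF _ u(1), of "inverse (1 + s)"] s1 by (auto simp: W_def)
    then have "(1 + s) *\<^sub>R (L (inverse (1 + s) *\<^sub>R u) + b) \<in> W" using coneW s1 unfolding W_def by blast
    also have "(1 + s) *\<^sub>R (L (inverse (1 + s) *\<^sub>R u) + b) = w + s *\<^sub>R b"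
      using s1 u(2) by (simp add: linear_scale[OF L(1)] scaleR_add_right scaleR_add_left)
    finally show ?thesis .
  qed
  \<comment> \<open>For \<open>s = -1\<close> the factor \<open>1 + s\<close> vanishes, so
    \<open>w\<close> is halved first, translated by half of \<open>b\<close>, and doubled.\<close>
  have shift: "w + s *\<^sub>R b \<in> W" if w: "w \<in> W" for w s
  proof (cases "s = -1")
    case True
    have "(1/2) *\<^sub>R w \<in> W" using coneW[of "1/2"] w unfolding W_def by simp
    then have "(1/2) *\<^sub>R w + (- (1/2)) *\<^sub>R b \<in> W" by (rule shift') simp
    then have "2 *\<^sub>R ((1/2) *\<^sub>R w + (- (1/2)) *\<^sub>R b) \<in> W" using coneW[of 2] unfolding W_def by simp
    then show ?thesis using True by (simp add: scaleR_diff_right)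
  qed (use shift' w in blast)
  have shiftU: "u + s *\<^sub>R a \<in> U" if u: "u \<in> U" for u s
  proof -
    have "L u + b + s *\<^sub>R b \<in> W" using shift u by (auto simp: W_def)
    then obtain u' where "u' \<in> U" "L u + b + s *\<^sub>R b = L u' + b" by (auto simp: W_def)
    moreover have "L (u + s *\<^sub>R a) = L u + s *\<^sub>R b" by (simp add: linear_add[OF L(1)] linear_scale[OF L(1)] a)
    ultimately have "L (u + s *\<^sub>R a) = L u'" by simp
    then show ?thesis using \<open>u' \<in> U\<close> L(3) by (metis injD)
  qed
  have one: "1 \<in> U" using e_in_Omega[of 1] U(1) by auto
  have "1 - e z * a dvd 1" for z
  proof (cases "z = 0")
    case False
    \<comment> \<open>Translations by real multiples of \<open>a\<close> suffice: translate
      \<open>1 / z\<close> by \<open>- a\<close> and multiply by \<open>z\<close>.\<close>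
    have "e (inverse z) * 1 + (-1) *\<^sub>R a \<in> U" using cone[OF _ one, of "inverse z"] False by (intro shiftU) simp
    then have "e z * (e (inverse z) * 1 + (-1) *\<^sub>R a) \<in> U" using cone False by blast
    also have "e z * (e (inverse z) * 1 + (-1) *\<^sub>R a) = 1 - e z * a"
      using e_cancel(1)[OF False, of 1] by (simp add: right_diff_distrib)
    finally show ?thesis using U(2) alg_units_iff_dvd by blast
  qed simp
  then have "a = 0" by (rule resolvent_entire_imp_zero[OF ss])
  then show ?thesis using a linear_0[OF L(1)] by simp
qed

end

section \<open>Transfer to the embedding of the scalars, and removal of the constant term\<close>

theorem theorem3p1:
  fixes sA :: "complex \<Rightarrow> 'a::{real_normed_algebra_1, banach, comm_ring_1} \<Rightarrow> 'a"
    and sB :: "complex \<Rightarrow> 'b::{real_normed_algebra_1, banach} \<Rightarrow> 'b"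
    and U :: "'a set" and V :: "'b set" and g :: 'b and T :: "'a \<Rightarrow> 'b"
  assumes "complex_alg_scalar sA"
    and "complex_alg_scalar sB"
    and "semisimple TYPE('a)"
    and "open U" and "Omega \<subseteq> U" and "U \<subseteq> alg_units"
    and "\<forall>c. c \<noteq> 0 \<longrightarrow> (\<forall>u\<in>U. sA c u \<in> U)"
    and "open V" and "Omega \<subseteq> V" and "V \<subseteq> alg_units"
    and "\<forall>c. c \<noteq> 0 \<longrightarrow> (\<forall>v\<in>V. sB c v \<in> V)"
    and "\<forall>v\<in>V. \<forall>w\<in>Omega. v * w \<in> V"
    and "g \<in> alg_units"
    and "T ` U = (\<lambda>v. g * v) ` V"
    and "\<forall>x\<in>U. \<forall>y\<in>U. dist (T x) (T y) = dist x y"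
  shows "\<exists>L :: 'a \<Rightarrow> 'b. linear L \<and> surj L \<and> (\<forall>x. norm (L x) = norm x) \<and>
           (\<forall>x\<in>U. L x = T x)"
proof -
  define e where "e c = sA c 1" for c
  have sA: "sA c x = e c * x" for c x
    using assms(1) unfolding complex_alg_scalar_def e_def by (metis mult_1_left)
  interpret complex_unital_algebra e
  proof
    show "e (b + c) = e b + e c" for b c
      using assms(1) unfolding complex_alg_scalar_def e_def by blast
    show "e (b * c) = e b * e c" for b c
      using assms(1) unfolding complex_alg_scalar_def by (metis e_def sA)
    show "e (complex_of_real r) = of_real r" for r
      using assms(1) unfolding complex_alg_scalar_def e_def of_real_def by blast
    show "norm (e c * x) = cmod c * norm x" for c x
      using assms(1) unfolding complex_alg_scalar_def by (metis sA)
  qed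
  have cone: "e c * u \<in> U" if "c \<noteq> 0" "u \<in> U" for c u
    using assms(7) that unfolding sA by blast
  have iso: "dist (T x) (T y) = dist x y" if "x \<in> U" "y \<in> U" for x y using assms(15) that by blast
  obtain k where k: "g * k = 1" "k * g = 1" using assms(13) by (auto simp: alg_units_def)
  have kg: "k * (g * x) = x" "g * (k * x) = x" for x
    using k by (simp_all flip: mult.assoc)
  \<comment> \<open>Multiplication by \<open>g\<close> has the continuous inverse given by
    \<open>k\<close>, so the image of \<open>V\<close> is open, being a preimage.\<close>
  have "(\<lambda>v. g * v) ` V = (\<lambda>w. k * w) -` V"
    by (auto simp: image_iff kg) (metis kg(2))
  then have openTU: "open (T ` U)"
    unfolding assms(14) using open_vimage[OF assms(8), of "\<lambda>w. k * w"] by (simp add: continuous_intros)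
  obtain L b where L: "linear L" "surj L" "\<And>x. norm (L x) = norm x" and Lb: "\<And>x. x \<in> U \<Longrightarrow> T x = L x + b"
    using isometry_on_cone_affine[OF assms(3,4) openTU assms(5) cone iso] by metis
  have img: "(\<lambda>x. L x + b) ` U = (\<lambda>v. g * v) ` V"
    using Lb assms(14) by (metis (no_types, lifting) image_cong)
  have "b = 0"
  proof (rule translation_zero[OF assms(3,5,6) cone _ L(1,2)])
    fix t :: real and w assume t: "t \<noteq> 0" and "w \<in> (\<lambda>x. L x + b) ` U"
    then obtain v where v: "v \<in> V" "w = g * v" unfolding img by blast
    have "t *\<^sub>R v = sB (complex_of_real t) v"
      using assms(2) unfolding complex_alg_scalar_def by metis
    then have "t *\<^sub>R v \<in> V" using assms(11) v(1) t by simp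
    then show "t *\<^sub>R w \<in> (\<lambda>x. L x + b) ` U" unfolding img v(2) by (metis image_eqI mult_scaleR_right)
  next
    show "inj L"
      using L(1,3) by (metis linear_injective_0 norm_eq_zero)
  qed
  then show ?thesis using L Lb by (intro exI[of _ L]) simp
qed

end
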